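(* Let $C(n)$ be any one of the following fifteen integer sequences (defined for all integers $n\ge 0$; sums over $k$ or $l$ range over all integers for which the summand is nonzero): (a) $\sum_k \binom{n}{k}^3$; (b) $\sum_k \binom{n}{k}^2\binom{n+k}{n}$; (c) $\sum_k \binom{n}{k}^2\binom{2k}{k}$; (d) $\sum_k \binom{n}{k}\binom{2k}{k}\binom{2(n-k)}{n-k}$; (f) $\sum_{k=0}^{\lfloor n/3\rfloor} (-1)^k 3^{n-3k}\binom{n}{3k}\frac{(3k)!}{k!^3}$; (g) $\sum_{k,l} (-1)^k 8^{n-k}\binom{n}{k}\binom{k}{l}^3$; $(\delta)$ $\sum_{k=0}^{\lfloor n/3\rfloor} (-1)^k 3^{n-3k}\binom{n}{3k}\binom{n+k}{n}\frac{(3k)!}{k!^3}$; $(\eta)$ $\sum_{k=0}^{n} (-1)^k \binom{n}{k}^3\binom{4n-5k}{3n}$; $(\alpha)$ $\sum_k \binom{n}{k}^2\binom{2k}{k}\binom{2(n-k)}{n-k}$; $(\epsilon)$ $\sum_k \binom{n}{k}^2\binom{2k}{n}^2$; $(\zeta)$ $\sum_{k,l}\binom{n}{k}^2\binom{n}{l}\binom{k}{l}\binom{k+l}{n}$; $(\gamma)$ $\sum_k \binom{n}{k}^2\binom{n+k}{n}^2$; $(s_7)$ $\sum_k \binom{n}{k}^2\binom{n+k}{k}\binom{2k}{n}$; $(s_{10})$ $\sum_k \binom{n}{k}^4$; $(s_{18})$ $\sum_{k=0}^{n} (-1)^k \binom{n}{k}\binom{2k}{k}\binom{2(n-k)}{n-k}\binom{2n-3k}{n}$.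 Then $C(n)$ satisfies the Lucas congruences: for every prime $p$ and every integer $n\ge 0$ with base-$p$ expansion $n=n_0+n_1p+\cdots+n_rp^r$ ($0\le n_i<p$), we have $C(n)\equiv C(n_0)C(n_1)\cdots C(n_r)\pmod p$.
   Context: Binomial coefficients with possibly negative upper entry are defined, for integers $m\ge0$ and any number $x$, by $\binom{x}{m}=\frac{x(x-1)\cdots(x-m+1)}{m!}$, and $\binom{x}{m}=0$ for negative integers $m$. (With this convention the sums for $(\eta)$ and $s_{18}$ agree with the forms $\sum_{k=0}^{\lfloor n/5\rfloor}(-1)^k\binom{n}{k}^3\bigl(\binom{4n-5k-1}{3n}+\binom{4n-5k}{3n}\bigr)$ and $\sum_{k=0}^{\lfloor n/3\rfloor}(-1)^k\binom{n}{k}\binom{2k}{k}\binom{2(n-k)}{n-k}\bigl[\binom{2n-3k-1}{n}+\binom{2n-3k}{n}\bigr]$ for $n\ge1$, and both sequences equal $1$ at $n=0$.) These are the sporadic Apéry-like sequences. *)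

theory Defs
  imports Complex_Main "HOL-Number_Theory.Number_Theory"
begin

text \<open>
  Sums over all integers \<open>k\<close> (and \<open>l\<close>) are written over the range outside of which a factor
  \<open>n choose k\<close> (respectively \<open>k choose l\<close> or \<open>n choose l\<close>) vanishes.
\<close>

definition seq_a :: "nat \<Rightarrow> int" where
  "seq_a n = (\<Sum>k=0..n. int (n choose k) ^ 3)"

definition seq_b :: "nat \<Rightarrow> int" where
  "seq_b n = (\<Sum>k=0..n. int (n choose k) ^ 2 * int ((n + k) choose n))"

definition seq_c :: "nat \<Rightarrow> int" where
  "seq_c n = (\<Sum>k=0..n. int (n choose k) ^ 2 * int ((2 * k) choose k))"

definition seq_d :: "nat \<Rightarrow> int" where
  "seq_d n = (\<Sum>k=0..n. int (n choose k) * int ((2 * k) choose k) * int ((2 * (n - k)) choose (n - k)))"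

text \<open>The integer division \<open>fact (3 * k) div fact k ^ 3\<close> below is exact.\<close>

lemma fact_cube_dvd_fact: "fact k ^ 3 dvd (fact (3 * k) :: int)"
proof -
  have "(fact k * fact k) * fact k dvd (fact (k + k) * fact k :: int)"
    by (intro mult_dvd_mono fact_fact_dvd_fact dvd_refl)
  also have "\<dots> dvd fact (k + k + k)"
    by (rule fact_fact_dvd_fact)
  finally show ?thesis
    by (simp add: power3_eq_cube mult.assoc flip: mult_2 mult_Suc add.assoc)
qed

definition seq_f :: "nat \<Rightarrow> int" where
  "seq_f n = (\<Sum>k=0..n div 3. (-1) ^ k * 3 ^ (n - 3 * k) * int (n choose (3 * k))
     * (fact (3 * k) div fact k ^ 3))"

definition seq_g :: "nat \<Rightarrow> int" where
  "seq_g n = (\<Sum>k=0..n. \<Sum>l=0..k. (-1) ^ k * 8 ^ (n - k) * int (n choose k) * int (k choose l) ^ 3)"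

definition seq_delta :: "nat \<Rightarrow> int" where
  "seq_delta n = (\<Sum>k=0..n div 3. (-1) ^ k * 3 ^ (n - 3 * k) * int (n choose (3 * k))
     * int ((n + k) choose n) * (fact (3 * k) div fact k ^ 3))"

text \<open>
  In \<open>seq_eta\<close> and \<open>seq_s18\<close> the upper entry of the last binomial coefficient can be negative.
  There \<open>int_gbinomial\<close> is used, which is the generalised binomial coefficient
  \<open>gchoose\<close> at type \<open>int\<close>; a separate constant is needed because \<open>gchoose\<close> carries a
  parser constraint to fields. The division by \<open>fact m\<close> is exact, as the lemma below shows.
\<close>

definition int_gbinomial :: "int \<Rightarrow> nat \<Rightarrow> int" where
  "int_gbinomial x m = (\<Prod>i=0..<m. x - int i) div fact m"

lemma of_int_int_gbinomial:
  "of_int (int_gbinomial x m) = (of_int x gchoose m :: 'a::field_char_0)"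
  using of_int_gbinomial[of x m, where 'a = 'a] by (simp add: int_gbinomial_def gbinomial_prod_rev)

definition seq_eta :: "nat \<Rightarrow> int" where
  "seq_eta n = (\<Sum>k=0..n. (-1) ^ k * int (n choose k) ^ 3 * int_gbinomial (4 * int n - 5 * int k) (3 * n))"

definition seq_alpha :: "nat \<Rightarrow> int" where
  "seq_alpha n = (\<Sum>k=0..n. int (n choose k) ^ 2 * int ((2 * k) choose k) * int ((2 * (n - k)) choose (n - k)))"

definition seq_epsilon :: "nat \<Rightarrow> int" where
  "seq_epsilon n = (\<Sum>k=0..n. int (n choose k) ^ 2 * int ((2 * k) choose n) ^ 2)"

definition seq_zeta :: "nat \<Rightarrow> int" where
  "seq_zeta n = (\<Sum>k=0..n. \<Sum>l=0..n. int (n choose k) ^ 2 * int (n choose l) * int (k choose l)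
     * int ((k + l) choose n))"

definition seq_gamma :: "nat \<Rightarrow> int" where
  "seq_gamma n = (\<Sum>k=0..n. int (n choose k) ^ 2 * int ((n + k) choose n) ^ 2)"

definition seq_s7 :: "nat \<Rightarrow> int" where
  "seq_s7 n = (\<Sum>k=0..n. int (n choose k) ^ 2 * int ((n + k) choose k) * int ((2 * k) choose n))"

definition seq_s10 :: "nat \<Rightarrow> int" where
  "seq_s10 n = (\<Sum>k=0..n. int (n choose k) ^ 4)"

definition seq_s18 :: "nat \<Rightarrow> int" where
  "seq_s18 n = (\<Sum>k=0..n. (-1) ^ k * int (n choose k) * int ((2 * k) choose k)
     * int ((2 * (n - k)) choose (n - k)) * int_gbinomial (2 * int n - 3 * int k) n)"

definition lucas_congruences :: "(nat \<Rightarrow> int) \<Rightarrow> bool" where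
  "lucas_congruences C \<longleftrightarrow>
     (\<forall>(p::nat) (n::nat) (r::nat) (d :: nat \<Rightarrow> nat).
        prime p \<longrightarrow> (\<forall>i\<le>r. d i < p) \<longrightarrow> n = (\<Sum>i=0..r. d i * p ^ i) \<longrightarrow>
        [C n = (\<Prod>i=0..r. C (d i))] (mod int p))"

end

theory Submission
  imports Defs "HOL-Computational_Algebra.Polynomial"
begin

text \<open>
  It suffices to prove \<open>C (a + p b) \<equiv> C a * C b\<close> modulo \<open>p\<close> for a last digit \<open>a < p\<close>. Writing the
  summation index as \<open>k = c + p d\<close>, Lucas' theorem splits the summands of thirteen of the sequences
  as (summand at \<open>a, c\<close>) times (summand at \<open>b, d\<close>): whenever a carry occurs, both sides vanish.

  For \<open>s\<^sub>1\<^sub>8\<close> and \<open>\<eta>\<close> carries survive, because the upper entry of the last binomial coefficient may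
  be negative. Lucas' theorem for integer upper entries then yields sums over \<open>d\<close> in which the
  entries are shifted by the carries. Pascal's rule and the reflection \<open>d \<mapsto> b - d\<close> express these
  shifted sums through \<open>C b\<close>, except for one extra sum that occurs for \<open>\<eta>\<close> when \<open>3 a \<ge> 2 p\<close>. Its
  coefficient is a sum over all residues \<open>c\<close> of a polynomial of degree \<open>p - 3\<close>, hence zero modulo \<open>p\<close>.
\<close>

section \<open>Lucas' theorem for integer upper entries\<close>

lemma int_gbinomial_0 [simp]: "int_gbinomial x 0 = 1"
  by (simp add: int_gbinomial_def)

text \<open>Over the rationals \<open>int_gbinomial\<close> becomes \<open>gchoose\<close>, and the
  embedding of the integers is injective, so identities of \<open>gchoose\<close> carry over. The
  same transfer is used for the next facts.\<close>

lemma int_gbinomial_Suc_Suc: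
  "int_gbinomial (x + 1) (Suc m) = int_gbinomial x m + int_gbinomial x (Suc m)"
proof -
  have "(of_int (int_gbinomial (x + 1) (Suc m)) :: rat)
      = of_int (int_gbinomial x m + int_gbinomial x (Suc m))"
    by (simp only: of_int_add of_int_int_gbinomial of_int_1 gbinomial_Suc_Suc)
  then show ?thesis
    by (simp only: of_int_eq_iff)
qed

lemma int_gbinomial_of_nat [simp]: "int_gbinomial (int n) m = int (n choose m)"
proof -
  have "(of_int (int_gbinomial (int n) m) :: rat) = of_int (int (n choose m))"
    by (simp add: of_int_int_gbinomial binomial_gbinomial)
  then show ?thesis
    by (simp only: of_int_eq_iff)
qed

lemma int_gbinomial_eq_binomial: "0 \<le> x \<Longrightarrow> int_gbinomial x m = int (nat x choose m)"
  using int_gbinomial_of_nat[of "nat x" m] by simp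

lemma int_gbinomial_eq_0: "0 \<le> x \<Longrightarrow> x < int m \<Longrightarrow> int_gbinomial x m = 0"
  by (simp add: int_gbinomial_eq_binomial)

lemma int_gbinomial_negated_upper:
  "int_gbinomial x m = (-1) ^ m * int_gbinomial (int m - x - 1) m"
proof -
  have "(of_int (int_gbinomial x m) :: rat) = of_int ((-1) ^ m * int_gbinomial (int m - x - 1) m)"
    using gbinomial_negated_upper[of "of_int x :: rat" m] by (simp add: of_int_int_gbinomial)
  then show ?thesis
    by (simp only: of_int_eq_iff)
qed

lemma int_gbinomial_mult_fact: "int_gbinomial x m * fact m = (\<Prod>i=0..<m. x - int i)"
proof -
  have "(of_int (int_gbinomial x m * fact m) :: rat) = of_int (\<Prod>i=0..<m. x - int i)"
    by (simp add: of_int_int_gbinomial gbinomial_prod_rev)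
  then show ?thesis
    by (simp only: of_int_eq_iff)
qed

text \<open>Applied to the difference of two solutions, this is uniqueness for Pascal's recurrence
  with given values on both axes. Upwards in \<open>x\<close> each value is a sum of two known ones;
  downwards the recurrence is solved for \<open>E (i - 1) (Suc m)\<close>, which takes an inner
  induction on \<open>m\<close>.\<close>

lemma pascal_recurrence_cong_0:
  fixes E :: "int \<Rightarrow> nat \<Rightarrow> int"
  assumes E0: "\<And>x. [E x 0 = 0] (mod p)" and E1: "\<And>m. [E 0 m = 0] (mod p)"
    and Suc: "\<And>x m. [E (x + 1) (Suc m) = E x m + E x (Suc m)] (mod p)"
  shows "[E x m = 0] (mod p)"
proof (induction x arbitrary: m rule: int_induct[where k = 0])
  case base
  show ?case by (rule E1)
next
  case (step1 i)
  show ?case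
  proof (cases m)
    case (Suc m')
    show ?thesis
      using assms(3)[of i m'] step1.IH[of m'] step1.IH[of m] Suc
      by (simp add: cong_0_iff cong_dvd_iff)
  qed (simp add: E0)
next
  case (step2 i)
  show ?case
  proof (induction m)
    case (Suc m)
    have "[E i (Suc m) = E (i - 1) m + E (i - 1) (Suc m)] (mod p)"
      using assms(3)[of "i - 1" m] by simp
    then have "p dvd E (i - 1) m + E (i - 1) (Suc m)"
      using step2.IH[of "Suc m"] by (simp add: cong_0_iff cong_dvd_iff)
    then show ?case
      using Suc by (simp add: cong_0_iff dvd_add_right_iff)
  qed (simp add: E0)
qed

text \<open>The right-hand side satisfies Pascal's recurrence modulo \<open>p\<close>, which determines it.\<close>

theorem int_gbinomial_lucas:
  assumes "prime p"
  shows "[int_gbinomial x m = int_gbinomial (x mod int p) (m mod p)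
           * int_gbinomial (x div int p) (m div p)] (mod int p)"
proof -
  define H where "H x m = int_gbinomial (x mod int p) (m mod p)
           * int_gbinomial (x div int p) (m div p)" for x m
  define E where "E x m = int_gbinomial x m - H x m" for x m
  have p: "p > 1" using assms by (rule prime_gt_1_nat)
  have HS: "[H (x + 1) (Suc m) = H x m + H x (Suc m)] (mod int p)" for x m
  proof -
    define x0 x1 where "x0 = x mod int p" and "x1 = x div int p"
    define m0 m1 where "m0 = m mod p" and "m1 = m div p"
    have x0: "0 \<le> x0" "x0 < int p" and m0: "m0 < p"
      using p by (auto simp: x0_def m0_def)
    have x: "x = x0 + int p * x1" and m: "m = m0 + p * m1"
      by (simp_all add: x0_def x1_def m0_def m1_def)
    have Hx: "H x m = int_gbinomial x0 m0 * int_gbinomial x1 m1"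
      by (simp add: H_def x0_def x1_def m0_def m1_def)
    have sm: "Suc m mod p = Suc m0 \<and> Suc m div p = m1" if "Suc m0 < p"
      using div_mult_self2[of p "Suc m0" m1] mod_mult_self2[of "Suc m0" p m1] m that p by simp
    have sm': "Suc m mod p = 0 \<and> Suc m div p = Suc m1" if "Suc m0 = p"
    proof -
      have "Suc m = p * Suc m1" using m that by simp
      then show ?thesis using p by (simp del: mult_Suc_right)
    qed
    have sx: "(x + 1) mod int p = x0 + 1 \<and> (x + 1) div int p = x1" if "x0 + 1 < int p"
    proof -
      have "x + 1 = (x0 + 1) + int p * x1" using x by simp
      then show ?thesis
        using that x0 p by (simp only: div_mult_self2 mod_mult_self2) simp
    qed
    have sx': "(x + 1) mod int p = 0 \<and> (x + 1) div int p = x1 + 1" if "x0 + 1 = int p"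
    proof -
      have "x + 1 = int p * (x1 + 1)" using x that by (simp add: algebra_simps)
      then show ?thesis using p by simp
    qed
    \<comment> \<open>The cases record whether adding 1 carries out of the last digit of
      \<open>x\<close> and of \<open>m\<close>. With no carry Pascal's rule acts on the last digits,
      with two carries on the quotients.\<close>
    consider "x0 + 1 < int p" "Suc m0 < p" | "x0 + 1 < int p" "Suc m0 = p"
      | "x0 + 1 = int p" "Suc m0 < p" | "x0 + 1 = int p" "Suc m0 = p"
      using x0 m0 by linarith
    then show ?thesis
    proof cases
      case 1
      then have "H (x + 1) (Suc m) = H x m + H x (Suc m)"
        unfolding Hx unfolding H_def using sx sm
        by (simp add: int_gbinomial_Suc_Suc distrib_right x0_def x1_def)
      then show ?thesis by simp
    next
      case 2
      then have "H x m = 0" unfolding Hx using x0 int_gbinomial_eq_0[of x0 m0] by simp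
      moreover have "H (x + 1) (Suc m) = H x (Suc m)"
        unfolding H_def using sx sm' 2 by (simp add: x1_def)
      ultimately show ?thesis by simp
    next
      case 3
      \<comment> \<open>Only \<open>x\<close> carries: the left-hand side has the factor
        \<open>0 choose Suc m0\<close>, and on the right the last digits add up to
        \<open>p choose Suc m0\<close>, which \<open>p\<close> divides since
        \<open>0 < Suc m0 < p\<close>.\<close>
      have "int_gbinomial x0 m0 + int_gbinomial x0 (Suc m0) = int_gbinomial (int p) (Suc m0)"
        using int_gbinomial_Suc_Suc[of x0 m0] 3 by simp
      also have "[\<dots> = 0] (mod int p)"
        using dvd_choose_prime[of "Suc m0" p] 3 assms p by (simp add: cong_0_iff)
      finally have "[(int_gbinomial x0 m0 + int_gbinomial x0 (Suc m0)) * int_gbinomial x1 m1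
          = 0 * int_gbinomial x1 m1] (mod int p)"
        by (rule cong_mult) simp
      moreover have "H x (Suc m) = int_gbinomial x0 (Suc m0) * int_gbinomial x1 m1"
        unfolding H_def using sm 3 by (simp add: x0_def x1_def)
      moreover have "H (x + 1) (Suc m) = 0"
        unfolding H_def using sm sx' 3 int_gbinomial_eq_0[of 0 "Suc m0"] by simp
      ultimately show ?thesis
        unfolding Hx by (simp add: algebra_simps cong_sym_eq)
    next
      case 4
      then have "x0 = int m0" by simp
      then have "int_gbinomial x0 m0 = 1" by simp
      then have "H (x + 1) (Suc m) = H x m + H x (Suc m)"
        unfolding Hx unfolding H_def using sx' sm' 4
        by (simp add: int_gbinomial_Suc_Suc x1_def)
      then show ?thesis by simp
    qed
  qed
  have "[E x m = 0] (mod int p)"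
  proof (rule pascal_recurrence_cong_0[where E = E])
    show "[E x 0 = 0] (mod int p)" for x
      by (simp add: E_def H_def)
    show "[E 0 m = 0] (mod int p)" for m
    proof (cases "m = 0")
      case False
      then have "m mod p > 0 \<or> m div p > 0"
        using p by (metis div_mult_mod_eq gr_zeroI mult_is_0 add.right_neutral)
      then show ?thesis
        using int_gbinomial_eq_0[of 0 m] int_gbinomial_eq_0[of 0 "m mod p"] int_gbinomial_eq_0[of 0 "m div p"] False
        by (auto simp: E_def H_def)
    qed (simp add: E_def H_def)
    show "[E (x + 1) (Suc m) = E x m + E x (Suc m)] (mod int p)" for x m
      using cong_diff[OF cong_refl[of "int_gbinomial (x + 1) (Suc m)"] HS[of x m]]
      by (simp add: E_def int_gbinomial_Suc_Suc add_diff_add)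
  qed
  then show ?thesis
    unfolding E_def H_def by (simp add: cong_diff_iff_cong_0)
qed

lemma binomial_lucas:
  assumes "prime p" "a < p" "c < p"
  shows "[int ((a + p * b) choose (c + p * d)) = int (a choose c) * int (b choose d)] (mod int p)"
proof -
  have "int (a + p * b) mod int p = int a" "int (a + p * b) div int p = int b"
    using assms by (simp_all flip: zmod_int zdiv_int)
  then show ?thesis
    using int_gbinomial_lucas[OF assms(1), of "int (a + p * b)" "c + p * d"] assms
    by (simp only: int_gbinomial_of_nat) simp
qed

text \<open>If \<open>x \<ge> p\<close>, its last digit \<open>x - p\<close> is below
  \<open>a\<close>, so both sides vanish modulo \<open>p\<close>. Hence a carry in upper entries
  such as \<open>a + c\<close> or \<open>2 * c\<close> does no harm.\<close>

lemma binomial_lucas_carry: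
  assumes "prime p" "a < p" "x < p + a"
  shows "[int ((x + p * y) choose (a + p * b)) = int (x choose a) * int (y choose b)] (mod int p)"
proof (cases "x < p")
  case True
  then show ?thesis using binomial_lucas assms by blast
next
  case False
  then obtain e where e: "x = e + p * 1" by (metis add.commute le_Suc_ex mult.right_neutral not_less)
  then have "e < a" "e < p" using assms by auto
  then have "[int ((e + p * (y + 1)) choose (a + p * b)) = 0] (mod int p)"
    "[int ((e + p * 1) choose (a + p * 0)) = 0] (mod int p)"
    using binomial_lucas[OF assms(1) _ assms(2), of e "y + 1" b]
      binomial_lucas[OF assms(1) _ assms(2), of e 1 0] by (simp_all add: binomial_eq_0)
  moreover from this(2) have "[int (x choose a) * int (y choose b) = 0 * int (y choose b)] (mod int p)"
    unfolding e by (intro cong_mult) simp_all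
  moreover have "x + p * y = e + p * (y + 1)"
    using e by simp
  ultimately show ?thesis
    by (metis cong_sym cong_trans mult_zero_left)
qed

text \<open>Outside \<open>c \<le> a\<close>, \<open>d \<le> b\<close> both sides vanish modulo
  \<open>p\<close>. The cofactor thus has to split only where \<open>n - k\<close> is computed
  without a borrow.\<close>

lemma binomial_mult_cong:
  assumes "prime p" "a < p" "c < p" "n = a + p * b" "k = c + p * d"
    and "c \<le> a \<Longrightarrow> d \<le> b \<Longrightarrow> [r = s * t] (mod int p)"
  shows "[int (n choose k) * r = (int (a choose c) * s) * (int (b choose d) * t)] (mod int p)"
proof (cases "c \<le> a \<and> d \<le> b")
  case True
  then show ?thesis
    using cong_mult[OF binomial_lucas[OF assms(1-3), of b d] assms(6)] assms(4,5)
    by (simp add: ac_simps)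
next
  case False
  then have *: "int (a choose c) * int (b choose d) = 0" by (auto simp: binomial_eq_0)
  then have "[int (n choose k) * r = 0 * r] (mod int p)"
    using binomial_lucas[OF assms(1-3), of b d] assms(4,5)
    by (intro cong_mult cong_refl) (simp only: *)
  moreover have "(int (a choose c) * s) * (int (b choose d) * t) = 0"
    using * by auto
  ultimately show ?thesis by (simp only: mult_zero_left)
qed

lemma int_power_prime_cong:
  fixes z :: int
  assumes "prime p"
  shows "[z ^ p = z] (mod int p)"
proof -
  define m where "m = nat (z mod int p)"
  have p: "p > 0" using assms by (rule prime_gt_0_nat)
  have m: "[z = int m] (mod int p)"
    using p by (simp add: m_def cong_def)
  have "[m ^ p = m] (mod p)"
  proof (cases "p dvd m")
    case True
    then show ?thesis
      using p by (meson cong_0_iff cong_sym cong_trans dvd_power dvd_trans)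
  next
    case False
    have "[m ^ (p - 1) * m = 1 * m] (mod p)"
      by (intro cong_mult fermat_theorem assms False cong_refl)
    then show ?thesis
      using p by (simp flip: power_Suc2)
  qed
  then have "[int m ^ p = int m] (mod int p)"
    by (metis cong_int_iff of_nat_power)
  then show ?thesis
    using m by (meson cong_pow cong_sym cong_trans)
qed

lemma power_digit_cong:
  fixes z :: int
  assumes "prime p"
  shows "[z ^ (a + p * b) = z ^ a * z ^ b] (mod int p)"
  unfolding power_add power_mult
  by (intro cong_mult cong_refl cong_pow int_power_prime_cong assms)

lemma mult_split_cong:
  fixes x :: int
  assumes "[x = s * t] (mod p)" "[x' = s' * t'] (mod p)"
  shows "[x * x' = (s * s') * (t * t')] (mod p)"
  using cong_mult[OF assms] by (simp add: ac_simps)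

lemma power_split_cong:
  fixes x :: int
  assumes "[x = s * t] (mod p)"
  shows "[x ^ m = s ^ m * t ^ m] (mod p)"
  using cong_pow[OF assms] by (simp add: power_mult_distrib)

section \<open>Splitting sums by base-p digits\<close>

text \<open>The range is filled up with zero terms to \<open>b + 1\<close> full blocks of length
  \<open>p\<close>.\<close>

lemma sum_digits:
  fixes f :: "nat \<Rightarrow> 'a :: comm_monoid_add"
  assumes "a < p" "\<And>k. a + p * b < k \<Longrightarrow> f k = 0"
  shows "(\<Sum>k=0..a + p * b. f k) = (\<Sum>d=0..b. \<Sum>c<p. f (c + p * d))"
proof -
  have "(\<Sum>k=0..a + p * b. f k) = (\<Sum>k<Suc b * p. f k)"
    using assms by (intro sum.mono_neutral_left) (auto simp: ac_simps not_le)
  also have "\<dots> = (\<Sum>d<Suc b. sum f {d * p..<d * p + p})"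
    by (rule sum.nat_group [symmetric])
  also have "\<dots> = (\<Sum>d<Suc b. \<Sum>c<p. f (c + p * d))"
  proof (rule sum.cong)
    fix d
    show "sum f {d * p..<d * p + p} = (\<Sum>c<p. f (c + p * d))"
      using sum.shift_bounds_nat_ivl[of f 0 "d * p" p]
      by (simp add: ac_simps atLeast0LessThan)
  qed simp
  also have "{..<Suc b} = {0..b}" by auto
  finally show ?thesis .
qed

text \<open>\<open>W\<close> may depend on \<open>c\<close>, which leaves room for a carry from the
  last digit to shift the sum over \<open>d\<close>.\<close>

lemma sum_binomial_digits_cong:
  assumes "prime p" "a < p"
    and "\<And>c d. c \<le> a \<Longrightarrow> d \<le> b \<Longrightarrow> [K (c + p * d) = V c * W c d] (mod int p)"
  shows "[(\<Sum>k=0..a + p * b. int ((a + p * b) choose k) * K k)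
    = (\<Sum>c=0..a. int (a choose c) * V c * (\<Sum>d=0..b. int (b choose d) * W c d))] (mod int p)"
proof -
  have "(\<Sum>k=0..a + p * b. int ((a + p * b) choose k) * K k)
      = (\<Sum>d=0..b. \<Sum>c<p. int ((a + p * b) choose (c + p * d)) * K (c + p * d))"
    using assms(2) by (rule sum_digits) simp
  also have "[\<dots> = (\<Sum>d=0..b. \<Sum>c<p. (int (a choose c) * V c) * (int (b choose d) * W c d))] (mod int p)"
    using assms by (intro cong_sum binomial_mult_cong) auto
  also have "(\<Sum>d=0..b. \<Sum>c<p. (int (a choose c) * V c) * (int (b choose d) * W c d))
      = (\<Sum>c<p. \<Sum>d=0..b. (int (a choose c) * V c) * (int (b choose d) * W c d))"
    by (rule sum.swap)
  also have "\<dots> = (\<Sum>c=0..a. \<Sum>d=0..b. (int (a choose c) * V c) * (int (b choose d) * W c d))"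
    using assms(2) by (intro sum.mono_neutral_right) (auto simp: binomial_eq_0)
  finally show ?thesis
    by (simp add: sum_distrib_left)
qed

section \<open>Reduction to splitting off the last digit\<close>

text \<open>Here \<open>b\<close> is an arbitrary number and not a digit, so that the congruence can
  be iterated.\<close>

definition lucas_mod :: "nat \<Rightarrow> (nat \<Rightarrow> int) \<Rightarrow> bool" where
  "lucas_mod p C \<longleftrightarrow> (\<forall>a b. a < p \<longrightarrow> [C (a + p * b) = C a * C b] (mod int p))"

lemma lucas_modI:
  "(\<And>a b. a < p \<Longrightarrow> [C (a + p * b) = C a * C b] (mod int p)) \<Longrightarrow> lucas_mod p C"
  by (simp add: lucas_mod_def)

lemma lucas_modD: "lucas_mod p C \<Longrightarrow> a < p \<Longrightarrow> [C (a + p * b) = C a * C b] (mod int p)"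
  by (simp add: lucas_mod_def)

text \<open>The factor belonging to \<open>d\<close> is the same for every \<open>c\<close>, so the
  double sum factors into \<open>C a * C b\<close>. One factor \<open>n choose k\<close> is kept
  apart to confine \<open>T\<close> to digits without a borrow.\<close>

lemma lucas_mod_binomial_sum:
  assumes "prime p"
    and C: "\<And>n. C n = (\<Sum>k=0..n. int (n choose k) * T n k)"
    and T: "\<And>a b c d. a < p \<Longrightarrow> c \<le> a \<Longrightarrow> d \<le> b \<Longrightarrow> [T (a + p * b) (c + p * d) = T a c * T b d] (mod int p)"
  shows "lucas_mod p C"
proof (rule lucas_modI)
  fix a b assume a: "a < p"
  show "[C (a + p * b) = C a * C b] (mod int p)"
    using sum_binomial_digits_cong[OF assms(1) a, of b "T (a + p * b)" "T a" "\<lambda>c. T b"] T[OF a]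
    by (simp add: C sum_distrib_right)
qed

text \<open>Induction on \<open>r\<close> for all digit sequences: \<open>d 0\<close> is split off
  and the hypothesis is used for the shifted digits \<open>d (Suc i)\<close>.\<close>

lemma lucas_congruencesI:
  assumes "\<And>p. prime p \<Longrightarrow> lucas_mod p C"
  shows "lucas_congruences C"
proof -
  have "[C (\<Sum>i=0..r. d i * p ^ i) = (\<Prod>i=0..r. C (d i))] (mod int p)"
    if "prime p" "\<forall>i\<le>r. d i < p" for p r and d :: "nat \<Rightarrow> nat"
    using that(2)
  proof (induction r arbitrary: d)
    case (Suc r)
    have "(\<Sum>i=0..Suc r. d i * p ^ i) = d 0 + p * (\<Sum>i=0..r. d (Suc i) * p ^ i)"
      by (simp add: sum.atLeast0_atMost_Suc_shift sum_distrib_left ac_simps del: sum.cl_ivl_Suc)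
    then have "[C (\<Sum>i=0..Suc r. d i * p ^ i) = C (d 0) * C (\<Sum>i=0..r. d (Suc i) * p ^ i)] (mod int p)"
      using lucas_modD[OF assms[OF that(1)], of "d 0" "\<Sum>i=0..r. d (Suc i) * p ^ i"] Suc.prems by simp
    also have "[C (d 0) * C (\<Sum>i=0..r. d (Suc i) * p ^ i) = C (d 0) * (\<Prod>i=0..r. C (d (Suc i)))] (mod int p)"
      using Suc.prems by (intro cong_mult cong_refl Suc.IH) auto
    also have "C (d 0) * (\<Prod>i=0..r. C (d (Suc i))) = (\<Prod>i=0..Suc r. C (d i))"
      by (simp add: prod.atLeast0_atMost_Suc_shift del: prod.cl_ivl_Suc)
    finally show ?case .
  qed simp
  then show ?thesis by (auto simp: lucas_congruences_def)
qed

section \<open>Sequences whose summands split\<close>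

lemma binomial_n_plus_k_cong:
  assumes "prime p" "a < p" "c < p"
  shows "[int ((a + p * b + (c + p * d)) choose (a + p * b))
    = int ((a + c) choose a) * int ((b + d) choose b)] (mod int p)"
  using binomial_lucas_carry[of p a "a + c" "b + d" b] assms by (simp add: algebra_simps)

lemma binomial_n_plus_k_cong':
  assumes "prime p" "a < p" "c < p"
  shows "[int ((a + p * b + (c + p * d)) choose (c + p * d))
    = int ((a + c) choose c) * int ((b + d) choose d)] (mod int p)"
  using binomial_lucas_carry[of p c "a + c" "b + d" d] assms by (simp add: algebra_simps)

lemma central_binomial_cong:
  assumes "prime p" "c < p"
  shows "[int ((2 * (c + p * d)) choose (c + p * d))
    = int ((2 * c) choose c) * int ((2 * d) choose d)] (mod int p)"
  using binomial_n_plus_k_cong[of p c c d d] assms by (simp only: mult_2)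

text \<open>From \<open>c \<le> a < p\<close> follows \<open>2 * c < p + a\<close>, the range of
  \<open>binomial_lucas_carry\<close>.\<close>

lemma binomial_2k_n_cong:
  assumes "prime p" "a < p" "c \<le> a"
  shows "[int ((2 * (c + p * d)) choose (a + p * b))
    = int ((2 * c) choose a) * int ((2 * d) choose b)] (mod int p)"
  using binomial_lucas_carry[of p a "2 * c" "2 * d" b] assms by (simp add: algebra_simps)

lemma diff_digits:
  fixes a b c d p :: nat
  assumes "c \<le> a" "d \<le> b"
  shows "a + p * b - (c + p * d) = (a - c) + p * (b - d)"
  using assms by (simp add: diff_mult_distrib2)

lemmas digit_cong_intros = mult_split_cong power_split_cong binomial_lucas power_digit_cong
  binomial_n_plus_k_cong binomial_n_plus_k_cong' central_binomial_cong binomial_2k_n_cong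

lemma lucas_seq_a: "lucas_mod p seq_a" if "prime p"
proof (rule lucas_mod_binomial_sum[OF that])
  show "seq_a n = (\<Sum>k=0..n. int (n choose k) * int (n choose k) ^ 2)" for n
    by (simp add: seq_a_def power3_eq_cube power2_eq_square mult.assoc)
qed (intro digit_cong_intros that, auto)

lemma lucas_seq_b: "lucas_mod p seq_b" if "prime p"
proof (rule lucas_mod_binomial_sum[OF that])
  show "seq_b n = (\<Sum>k=0..n. int (n choose k) * (int (n choose k) * int ((n + k) choose n)))" for n
    by (simp add: seq_b_def power2_eq_square mult.assoc)
qed (intro digit_cong_intros that, auto)

lemma lucas_seq_c: "lucas_mod p seq_c" if "prime p"
proof (rule lucas_mod_binomial_sum[OF that])
  show "seq_c n = (\<Sum>k=0..n. int (n choose k) * (int (n choose k) * int ((2 * k) choose k)))" for n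
    by (simp add: seq_c_def power2_eq_square mult.assoc)
qed (intro digit_cong_intros that, auto)

lemma lucas_seq_d: "lucas_mod p seq_d" if "prime p"
proof (rule lucas_mod_binomial_sum[OF that])
  show "seq_d n = (\<Sum>k=0..n. int (n choose k)
      * (int ((2 * k) choose k) * int ((2 * (n - k)) choose (n - k))))" for n
    by (simp add: seq_d_def mult.assoc)
qed (unfold diff_digits, intro digit_cong_intros that, auto)

text \<open>The inner sum over \<open>l\<close> is \<open>seq_a k\<close>, whose own splitting
  modulo \<open>p\<close> is already available.\<close>

lemma lucas_seq_g: "lucas_mod p seq_g" if "prime p"
proof (rule lucas_mod_binomial_sum[OF that])
  show "seq_g n = (\<Sum>k=0..n. int (n choose k) * ((-1) ^ k * 8 ^ (n - k) * seq_a k))" for n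
    by (simp add: seq_g_def seq_a_def sum_distrib_left ac_simps)
qed (unfold diff_digits, intro digit_cong_intros lucas_modD lucas_seq_a that, auto)

lemma lucas_seq_alpha: "lucas_mod p seq_alpha" if "prime p"
proof (rule lucas_mod_binomial_sum[OF that])
  show "seq_alpha n = (\<Sum>k=0..n. int (n choose k)
      * (int (n choose k) * int ((2 * k) choose k) * int ((2 * (n - k)) choose (n - k))))" for n
    by (simp add: seq_alpha_def power2_eq_square mult.assoc)
qed (unfold diff_digits, intro digit_cong_intros that, auto)

lemma lucas_seq_epsilon: "lucas_mod p seq_epsilon" if "prime p"
proof (rule lucas_mod_binomial_sum[OF that])
  show "seq_epsilon n = (\<Sum>k=0..n. int (n choose k) * (int (n choose k) * int ((2 * k) choose n) ^ 2))" for n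
    by (simp add: seq_epsilon_def power2_eq_square mult.assoc)
qed (intro digit_cong_intros that, auto)

lemma lucas_seq_gamma: "lucas_mod p seq_gamma" if "prime p"
proof (rule lucas_mod_binomial_sum[OF that])
  show "seq_gamma n = (\<Sum>k=0..n. int (n choose k) * (int (n choose k) * int ((n + k) choose n) ^ 2))" for n
    by (simp add: seq_gamma_def power2_eq_square mult.assoc)
qed (intro digit_cong_intros that, auto)

lemma lucas_seq_s7: "lucas_mod p seq_s7" if "prime p"
proof (rule lucas_mod_binomial_sum[OF that])
  show "seq_s7 n = (\<Sum>k=0..n. int (n choose k)
      * (int (n choose k) * int ((n + k) choose k) * int ((2 * k) choose n)))" for n
    by (simp add: seq_s7_def power2_eq_square mult.assoc)
qed (intro digit_cong_intros that, auto)

lemma lucas_seq_s10: "lucas_mod p seq_s10" if "prime p"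
proof (rule lucas_mod_binomial_sum[OF that])
  show "seq_s10 n = (\<Sum>k=0..n. int (n choose k) * int (n choose k) ^ 3)" for n
    by (simp add: seq_s10_def power3_eq_cube power4_eq_xxxx mult.assoc)
qed (intro digit_cong_intros that, auto)

text \<open>The digit argument is applied twice: first to the inner sum \<open>?S\<close> over
  \<open>l = e + p * f\<close>, then to the outer sum with \<open>?S\<close> as a factor that
  splits. Since \<open>c\<close> and \<open>e\<close> are at most \<open>a\<close>, the bound
  \<open>c + e < p + a\<close> holds.\<close>

lemma lucas_seq_zeta: "lucas_mod p seq_zeta" if "prime p"
proof (rule lucas_mod_binomial_sum[OF that])
  let ?S = "\<lambda>n k. \<Sum>l=0..n. int (n choose l) * (int (k choose l) * int ((k + l) choose n))"
  show "seq_zeta n = (\<Sum>k=0..n. int (n choose k) * (int (n choose k) * ?S n k))" for n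
    by (simp add: seq_zeta_def sum_distrib_left power2_eq_square mult.assoc)
  fix a b c d assume *: "a < p" "c \<le> a"
  have "[?S (a + p * b) (c + p * d) = (\<Sum>e=0..a. int (a choose e) * (int (c choose e) * int ((c + e) choose a))
      * (\<Sum>f=0..b. int (b choose f) * (int (d choose f) * int ((d + f) choose b))))] (mod int p)"
  proof (rule sum_binomial_digits_cong[OF that *(1)])
    fix e f assume "e \<le> a"
    then have "[int ((c + p * d + (e + p * f)) choose (a + p * b))
        = int ((c + e) choose a) * int ((d + f) choose b)] (mod int p)"
      using binomial_lucas_carry[OF that *(1), of "c + e" "d + f" b] * by (simp add: algebra_simps)
    then show "[int ((c + p * d) choose (e + p * f)) * int ((c + p * d + (e + p * f)) choose (a + p * b))
        = (int (c choose e) * int ((c + e) choose a)) * (int (d choose f) * int ((d + f) choose b))] (mod int p)"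
      using * \<open>e \<le> a\<close> by (intro mult_split_cong binomial_lucas that) auto
  qed
  then have "[?S (a + p * b) (c + p * d) = ?S a c * ?S b d] (mod int p)"
    by (simp add: sum_distrib_right)
  then show "[int ((a + p * b) choose (c + p * d)) * ?S (a + p * b) (c + p * d)
      = (int (a choose c) * ?S a c) * (int (b choose d) * ?S b d)] (mod int p)"
    using * by (intro mult_split_cong binomial_lucas that) auto
qed

section \<open>Sequences containing \<open>(3k)!/k!^3\<close>\<close>

text \<open>Both sides count ordered triples of disjoint \<open>k\<close>-subsets of an
  \<open>n\<close>-set. The right-hand side has only \<open>k\<close> as lower entry, so it can be
  split digit by digit.\<close>

lemma trinomial_eq:
  assumes "3 * k \<le> n"
  shows "int (n choose (3 * k)) * (fact (3 * k) div fact k ^ 3)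
    = int (n choose k) * (int ((n - k) choose k) * int ((n - k - k) choose k))"
proof -
  have "fact k * fact (2 * k) * ((3 * k) choose k) = (fact (3 * k) :: nat)"
    "fact k * fact k * ((2 * k) choose k) = (fact (2 * k) :: nat)"
    using binomial_fact_lemma[of k "3 * k"] binomial_fact_lemma[of k "2 * k"] by (simp_all add: mult.assoc flip: mult_2)
  then have "fact (3 * k) = fact k ^ 3 * (((3 * k) choose k) * ((2 * k) choose k))"
    by (metis (no_types, lifting) ab_semigroup_mult_class.mult_ac(1) mult.commute power3_eq_cube)
  then have "(fact (3 * k) :: int) = fact k ^ 3 * int (((3 * k) choose k) * ((2 * k) choose k))"
    by (metis of_nat_fact of_nat_mult of_nat_power)
  then have "(fact (3 * k) div fact k ^ 3 :: int) = int (((3 * k) choose k) * ((2 * k) choose k))"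
    by simp
  moreover have "(n choose (3 * k)) * ((3 * k) choose k) = (n choose k) * ((n - k) choose (2 * k))"
    "((n - k) choose (2 * k)) * ((2 * k) choose k) = ((n - k) choose k) * ((n - k - k) choose k)"
    using choose_mult[of k "3 * k" n] choose_mult[of k "2 * k" "n - k"] assms by simp_all
  then have "(n choose (3 * k)) * (((3 * k) choose k) * ((2 * k) choose k))
      = (n choose k) * (((n - k) choose k) * ((n - k - k) choose k))"
    by (metis mult.assoc)
  ultimately show ?thesis
    by (metis of_nat_mult)
qed

lemma trinomial_sum_eq:
  "(\<Sum>k=0..n div 3. f k * int (n choose (3 * k)) * (fact (3 * k) div fact k ^ 3))
    = (\<Sum>k=0..n. int (n choose k) * (int ((n - k) choose k) * (int ((n - k - k) choose k) * f k)))"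
proof -
  have "int (n choose k) * (int ((n - k) choose k) * (int ((n - k - k) choose k) * f k)) = 0"
    if "k \<notin> {0..n div 3}" for k
  proof -
    have "n < 3 * k" using that by auto
    \<comment> \<open>For \<open>n < 3 * k\<close> one of the three successive choices of
      \<open>k\<close> elements is impossible.\<close>
    then consider "n < k" | "n - k < k" | "n - k - k < k" by linarith
    then show ?thesis by cases (simp_all add: binomial_eq_0)
  qed
  then have "(\<Sum>k=0..n. int (n choose k) * (int ((n - k) choose k) * (int ((n - k - k) choose k) * f k)))
      = (\<Sum>k=0..n div 3. int (n choose k) * (int ((n - k) choose k) * (int ((n - k - k) choose k) * f k)))"
    by (intro sum.mono_neutral_right) auto
  also have "\<dots> = (\<Sum>k=0..n div 3. f k * int (n choose (3 * k)) * (fact (3 * k) div fact k ^ 3))"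
    using trinomial_eq[of _ n] by (intro sum.cong) (auto simp: ac_simps)
  finally show ?thesis by simp
qed

lemma lucas_mod_trinomial_sum:
  assumes "prime p"
    and C: "\<And>n. C n = (\<Sum>k=0..n div 3. (-1) ^ k * 3 ^ (n - 3 * k) * int (n choose (3 * k))
      * T n k * (fact (3 * k) div fact k ^ 3))"
    and T: "\<And>a b c d. a < p \<Longrightarrow> c < p \<Longrightarrow> [T (a + p * b) (c + p * d) = T a c * T b d] (mod int p)"
  shows "lucas_mod p C"
proof (rule lucas_mod_binomial_sum[OF assms(1)])
  show "C n = (\<Sum>k=0..n. int (n choose k) * (int ((n - k) choose k)
      * (int ((n - k - k) choose k) * ((-1) ^ k * 3 ^ (n - k - k - k) * T n k))))" for n
  proof -
    \<comment> \<open>Iterated subtraction lets \<open>diff_digits\<close> act one borrow-free step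
      at a time.\<close>
    have "n - 3 * k = n - k - k - k" for k by simp
    then show ?thesis
      unfolding C trinomial_sum_eq[symmetric] by (simp add: ac_simps)
  qed
  fix a b c d :: nat assume *: "a < p" "c \<le> a" "d \<le> b"
  show "[int ((a + p * b - (c + p * d)) choose (c + p * d))
      * (int ((a + p * b - (c + p * d) - (c + p * d)) choose (c + p * d))
      * ((-1) ^ (c + p * d) * 3 ^ (a + p * b - (c + p * d) - (c + p * d) - (c + p * d))
      * T (a + p * b) (c + p * d)))
    = (int ((a - c) choose c) * (int ((a - c - c) choose c) * ((-1) ^ c * 3 ^ (a - c - c - c) * T a c)))
    * (int ((b - d) choose d) * (int ((b - d - d) choose d) * ((-1) ^ d * 3 ^ (b - d - d - d) * T b d)))] (mod int p)"
  \<comment> \<open>The rule applies to both remaining binomial coefficients, and each one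
    contributes the assumption that the next subtraction of \<open>c\<close> and \<open>d\<close>
    needs no borrow.\<close>
  proof (intro binomial_mult_cong assms(1))
    assume **: "c \<le> a - c" "d \<le> b - d" "c \<le> a - c - c" "d \<le> b - d - d"
    have "3 ^ (a + p * b - (c + p * d) - (c + p * d) - (c + p * d))
        = (3 :: int) ^ (a - c - c - c + p * (b - d - d - d))"
      using * ** by (simp only: diff_digits)
    then show "[(-1) ^ (c + p * d) * 3 ^ (a + p * b - (c + p * d) - (c + p * d) - (c + p * d)) * T (a + p * b) (c + p * d)
      = ((-1) ^ c * 3 ^ (a - c - c - c) * T a c) * ((-1) ^ d * 3 ^ (b - d - d - d) * T b d)] (mod int p)"
      using * by (simp only:, intro mult_split_cong power_digit_cong assms T) auto
  qed ((use * in \<open>linarith | simp only: diff_digits\<close>)+)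
qed

lemma lucas_seq_f: "lucas_mod p seq_f" if "prime p"
  by (rule lucas_mod_trinomial_sum[OF that, where T = "\<lambda>n k. 1"]) (simp_all add: seq_f_def)

lemma lucas_seq_delta: "lucas_mod p seq_delta" if "prime p"
  by (rule lucas_mod_trinomial_sum[OF that, where T = "\<lambda>n k. int ((n + k) choose n)"])
    (auto simp: seq_delta_def intro: binomial_n_plus_k_cong that)

section \<open>The sequences with surviving carries\<close>

text \<open>\<open>x\<close> and \<open>m\<close> may lie outside the digit range; their quotients
  by \<open>p\<close> are the carries passed on to \<open>y\<close> and \<open>l\<close>.\<close>

lemma int_gbinomial_digits_cong:
  assumes "prime p"
  shows "[int_gbinomial (x + int p * y) (m + p * l) = int_gbinomial (x mod int p) (m mod p)
    * int_gbinomial (y + x div int p) (l + m div p)] (mod int p)"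
  using int_gbinomial_lucas[OF assms, of "x + int p * y" "m + p * l"] prime_gt_0_nat[OF assms]
  by simp

lemma int_gbinomial_mod_cong:
  assumes "prime p" "m < p"
  shows "[int_gbinomial x m = int_gbinomial (x mod int p) m] (mod int p)"
  using int_gbinomial_lucas[OF assms(1), of x m] assms(2) by simp

lemma minus_one_power_diff: "k \<le> n \<Longrightarrow> (-1 :: int) ^ (n - k) = (-1) ^ n * (-1) ^ k"
  by (simp add: minus_one_power_iff)

text \<open>Borrows shift the upper entry of the digitwise coefficient by \<open>-1\<close>; reversing the order of
  summation shows that the shifted sum \<open>F (-1)\<close> still equals \<open>seq_s18 b\<close>.\<close>

lemma lucas_seq_s18: "lucas_mod p seq_s18" if "prime p"
proof (rule lucas_modI)
  fix a b assume a: "a < p"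
  \<comment> \<open>\<open>q\<close> stands for the carry, that is, the quotient of
    \<open>2 * a - 3 * c\<close> by \<open>p\<close>.\<close>
  define F where "F q = (\<Sum>d=0..b. int (b choose d) * ((-1) ^ d * int ((2 * d) choose d)
    * int ((2 * (b - d)) choose (b - d)) * int_gbinomial (2 * int b - 3 * int d + q) b))" for q
  define A where "A c = (-1) ^ c * int ((2 * c) choose c) * int ((2 * (a - c)) choose (a - c))" for c
  define x where "x c = 2 * int a - 3 * int c" for c
  have F0: "F 0 = seq_s18 b"
    by (simp add: F_def seq_s18_def ac_simps)
  have F1: "F (-1) = F 0"
  proof -
    have "F (-1) = (\<Sum>d=0..b. int (b choose (b - d)) * ((-1) ^ (b - d) * int ((2 * (b - d)) choose (b - d))
      * int ((2 * (b - (b - d))) choose (b - (b - d)))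
      * int_gbinomial (2 * int b - 3 * int (b - d) + (-1)) b))"
      unfolding F_def by (subst sum.atLeastAtMost_rev) simp
    also have "\<dots> = F 0"
      unfolding F_def
    proof (rule sum.cong)
      fix d assume "d \<in> {0..b}"
      then have d: "d \<le> b" by simp
      \<comment> \<open>Negating the upper entry turns \<open>- b + 3 * d - 1\<close> into
        \<open>2 * b - 3 * d\<close>. Its sign \<open>(-1) ^ b\<close> cancels against the one from
        \<open>(-1) ^ (b - d)\<close>.\<close>
      have "int_gbinomial (2 * int b - 3 * int (b - d) + (-1)) b
          = (-1) ^ b * int_gbinomial (2 * int b - 3 * int d + 0) b"
        using int_gbinomial_negated_upper[of "2 * int b - 3 * int (b - d) + (-1)" b] d
        by (simp add: algebra_simps)
      then show "int (b choose (b - d)) * ((-1) ^ (b - d) * int ((2 * (b - d)) choose (b - d))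
          * int ((2 * (b - (b - d))) choose (b - (b - d)))
          * int_gbinomial (2 * int b - 3 * int (b - d) + (-1)) b)
        = int (b choose d) * ((-1) ^ d * int ((2 * d) choose d)
          * int ((2 * (b - d)) choose (b - d)) * int_gbinomial (2 * int b - 3 * int d + 0) b)"
        using d by (simp add: minus_one_power_diff binomial_symmetric[symmetric] ac_simps flip: power_mult_distrib)
    qed simp
    finally show ?thesis .
  qed
  have "[seq_s18 (a + p * b) = (\<Sum>c=0..a. int (a choose c)
      * (A c * int_gbinomial (x c mod int p) a) * F (x c div int p))] (mod int p)"
    unfolding F_def
  proof -
    let ?n = "a + p * b"
    have eq: "seq_s18 ?n = (\<Sum>k=0..?n. int (?n choose k) * ((-1) ^ k * int ((2 * k) choose k)
        * int ((2 * (?n - k)) choose (?n - k)) * int_gbinomial (2 * int ?n - 3 * int k) ?n))"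
      by (simp add: seq_s18_def ac_simps)
    show "[seq_s18 ?n = (\<Sum>c=0..a. int (a choose c) * (A c * int_gbinomial (x c mod int p) a)
      * (\<Sum>d=0..b. int (b choose d) * ((-1) ^ d * int ((2 * d) choose d)
       * int ((2 * (b - d)) choose (b - d)) * int_gbinomial (2 * int b - 3 * int d + x c div int p) b)))] (mod int p)"
      unfolding eq
    proof (rule sum_binomial_digits_cong[OF that a])
      fix c d assume cd: "c \<le> a" "d \<le> b"
      have "2 * int ?n - 3 * int (c + p * d) = x c + int p * (2 * int b - 3 * int d)"
        by (simp add: x_def algebra_simps)
      then have "[int_gbinomial (2 * int ?n - 3 * int (c + p * d)) ?n
         = int_gbinomial (x c mod int p) a * int_gbinomial (2 * int b - 3 * int d + x c div int p) b] (mod int p)"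
        using int_gbinomial_digits_cong[OF that, of "x c" "2 * int b - 3 * int d" a b] a by simp
      then show "[(-1) ^ (c + p * d) * int ((2 * (c + p * d)) choose (c + p * d))
          * int ((2 * (?n - (c + p * d))) choose (?n - (c + p * d)))
          * int_gbinomial (2 * int ?n - 3 * int (c + p * d)) ?n
        = (A c * int_gbinomial (x c mod int p) a) * ((-1) ^ d * int ((2 * d) choose d)
          * int ((2 * (b - d)) choose (b - d)) * int_gbinomial (2 * int b - 3 * int d + x c div int p) b)] (mod int p)"
        unfolding A_def diff_digits[OF cd] using a cd
        by (intro mult_split_cong power_digit_cong central_binomial_cong that) simp_all
    qed
  qed
  also have "(\<Sum>c=0..a. int (a choose c) * (A c * int_gbinomial (x c mod int p) a) * F (x c div int p))
      = (\<Sum>c=0..a. int (a choose c) * (A c * int_gbinomial (x c mod int p) a) * seq_s18 b)"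
  proof (rule sum.cong)
    fix c assume "c \<in> {0..a}"
    then have x: "- int p < x c" "x c < int p + int a"
      using a by (auto simp: x_def)
    \<comment> \<open>The possible carries are -1, 0 and 1. For carry 1 the last digit
      \<open>x c - p\<close> is below \<open>a\<close>, so the coefficient vanishes.\<close>
    consider "- int p < x c" "x c < 0" | "0 \<le> x c" "x c < int p" | "int p \<le> x c" "x c < int p + int a"
      using x by linarith
    then have "F (x c div int p) = seq_s18 b \<or> int_gbinomial (x c mod int p) a = 0"
    proof cases
      case 1
      then have "(x c + int p) div int p = 0" by (intro div_pos_pos_trivial) auto
      moreover have "(x c + int p) div int p = x c div int p + 1"
        using a by (intro div_add_self2) simp
      ultimately have "x c div int p = -1" by linarith
      then show ?thesis using F0 F1 by simp
    next
      case 2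
      then show ?thesis using F0 by simp
    next
      case 3
      have "x c mod int p = (x c - int p) mod int p" by simp
      also have "\<dots> = x c - int p" using 3 a by (intro mod_pos_pos_trivial) auto
      finally show ?thesis using 3 int_gbinomial_eq_0[of "x c - int p" a] by simp
    qed
    then show "int (a choose c) * (A c * int_gbinomial (x c mod int p) a) * F (x c div int p)
      = int (a choose c) * (A c * int_gbinomial (x c mod int p) a) * seq_s18 b" by auto
  qed simp
  \<comment> \<open>As \<open>a < p\<close>, the second factor in Lucas' theorem is 1, so
    \<open>x c mod p\<close> may be replaced by \<open>x c\<close> again.\<close>
  also have "[(\<Sum>c=0..a. int (a choose c) * (A c * int_gbinomial (x c mod int p) a) * seq_s18 b)
      = (\<Sum>c=0..a. int (a choose c) * (A c * int_gbinomial (x c) a) * seq_s18 b)] (mod int p)"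
    using int_gbinomial_mod_cong[OF that a] by (intro cong_sum cong_mult cong_refl) (simp add: cong_sym_eq)
  also have "(\<Sum>c=0..a. int (a choose c) * (A c * int_gbinomial (x c) a) * seq_s18 b) = seq_s18 a * seq_s18 b"
    unfolding sum_distrib_right[symmetric] by (simp add: seq_s18_def[of a] A_def x_def ac_simps)
  finally show "[seq_s18 (a + p * b) = seq_s18 a * seq_s18 b] (mod int p)" .
qed

section \<open>Sums of polynomials over all residues modulo a prime\<close>

text \<open>Telescoping \<open>(c + 1) ^ Suc j - c ^ Suc j\<close> writes \<open>p ^ Suc j\<close>
  as a combination of the power sums up to exponent \<open>j\<close>. The lower ones vanish by
  induction, and the coefficient \<open>Suc j < p\<close> of the last is prime to
  \<open>p\<close>.\<close>

lemma power_sum_cong_0: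
  assumes "prime p" "j < p - 1"
  shows "[(\<Sum>c<p. int c ^ j) = 0] (mod int p)"
  using assms(2)
proof (induction j rule: less_induct)
  case (less j)
  let ?S = "\<lambda>i. \<Sum>c<p. int c ^ i"
  have "int p ^ Suc j = (\<Sum>c<p. int (Suc c) ^ Suc j - int c ^ Suc j)"
    by (subst sum_lessThan_telescope) simp
  also have "\<dots> = (\<Sum>c<p. \<Sum>i\<le>j. int (Suc j choose i) * int c ^ i)"
  proof (rule sum.cong)
    fix c
    have "int (Suc c) ^ Suc j = (int c + 1) ^ Suc j" by (simp add: add.commute)
    also have "\<dots> = (\<Sum>i\<le>Suc j. int (Suc j choose i) * int c ^ i)"
      by (subst binomial_ring) simp
    finally show "int (Suc c) ^ Suc j - int c ^ Suc j = (\<Sum>i\<le>j. int (Suc j choose i) * int c ^ i)"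
      by simp
  qed simp
  also have "\<dots> = (\<Sum>i\<le>j. int (Suc j choose i) * ?S i)"
    by (subst sum.swap) (simp add: sum_distrib_left)
  also have "\<dots> = (\<Sum>i<j. int (Suc j choose i) * ?S i) + int (Suc j) * ?S j"
    by (simp add: lessThan_Suc_atMost[symmetric])
  finally have eq: "int p ^ Suc j = (\<Sum>i<j. int (Suc j choose i) * ?S i) + int (Suc j) * ?S j" .
  have "int p dvd (\<Sum>i<j. int (Suc j choose i) * ?S i)"
  proof (rule dvd_sum, rule dvd_mult)
    show "int p dvd ?S i" if "i \<in> {..<j}" for i
      using less.IH[of i] less.prems that by (simp add: cong_0_iff)
  qed
  moreover have "int p dvd int p ^ Suc j" by simp
  ultimately have "int p dvd int (Suc j) * ?S j"
    unfolding eq by (simp only: dvd_add_right_iff)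
  moreover have "\<not> int p dvd int (Suc j)"
    using less.prems unfolding int_dvd_int_iff by (auto dest!: dvd_imp_le)
  ultimately show ?case
    using assms(1) by (simp only: prime_dvd_mult_iff prime_nat_int_transfer cong_0_iff) simp
qed

lemma poly_sum_cong_0:
  assumes "prime p" "Polynomial.degree P < p - 1"
  shows "[(\<Sum>c<p. poly P (int c)) = 0] (mod int p)"
proof -
  have "(\<Sum>c<p. poly P (int c)) = (\<Sum>i\<le>Polynomial.degree P. Polynomial.coeff P i * (\<Sum>c<p. int c ^ i))"
    unfolding poly_altdef by (subst sum.swap) (simp add: sum_distrib_left)
  also have "[\<dots> = (\<Sum>i\<le>Polynomial.degree P. Polynomial.coeff P i * 0)] (mod int p)"
    using assms by (intro cong_sum cong_mult cong_refl power_sum_cong_0) auto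
  finally show ?thesis by simp
qed

text \<open>Modulo \<open>p\<close>, the coefficient \<open>a choose c\<close> equals \<open>(a - p) choose c\<close>, which up to sign is a
  polynomial in \<open>c\<close> of degree \<open>p - 1 - a\<close>.\<close>

lemma binomial_cong_polynomial:
  assumes "prime p" "a < p" "c < p"
  shows "[(-1) ^ c * int (a choose c) * fact (p - 1 - a)
    = (\<Prod>i=0..<p - 1 - a. int c + int (p - 1 - a) - int i)] (mod int p)"
proof -
  define m where "m = p - 1 - a"
  have "[int_gbinomial (int a) c = int_gbinomial (int a mod int p) c] (mod int p)"
    by (rule int_gbinomial_mod_cong[OF assms(1,3)])
  moreover have "[int_gbinomial (int a - int p) c = int_gbinomial (int a mod int p) c] (mod int p)"
    using int_gbinomial_mod_cong[OF assms(1,3), of "int a - int p"] by simp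
  ultimately have "[int_gbinomial (int a) c = int_gbinomial (int a - int p) c] (mod int p)"
    by (meson cong_sym cong_trans)
  \<comment> \<open>Negating the upper entry turns \<open>a - p\<close> into \<open>c + m\<close>;
    symmetry then replaces the lower entry \<open>c\<close> by the constant
    \<open>m\<close>.\<close>
  moreover have "int_gbinomial (int a - int p) c = (-1) ^ c * int ((c + m) choose m)"
  proof -
    have "int_gbinomial (int a - int p) c = (-1) ^ c * int_gbinomial (int (c + m)) c"
      using assms(2) by (subst int_gbinomial_negated_upper) (simp add: m_def of_nat_diff algebra_simps)
    then show ?thesis
      using binomial_symmetric[of m "c + m"] by (simp only: int_gbinomial_of_nat) simp
  qed
  ultimately have "[(-1) ^ c * int (a choose c) * fact m
      = (-1) ^ c * ((-1) ^ c * int ((c + m) choose m)) * fact m] (mod int p)"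
    by (intro cong_mult cong_refl) simp
  also have "(-1) ^ c * ((-1) ^ c * int ((c + m) choose m)) * fact m
      = (\<Prod>i=0..<m. int c + int m - int i)"
    using int_gbinomial_mult_fact[of "int (c + m)" m]
    by (simp only: int_gbinomial_of_nat) (simp flip: mult.assoc power_mult_distrib)
  finally show ?thesis by (simp add: m_def)
qed

text \<open>Multiplied by \<open>fact m ^ 3 * fact s\<close>, which is prime to \<open>p\<close>,
  the summand agrees modulo \<open>p\<close> with a polynomial in \<open>c\<close> of degree below
  \<open>p - 1\<close>. Terms with \<open>a < c < p\<close> are zero, so the sum may run over all
  residues.\<close>

lemma binomial_cube_sum_cong_0:
  assumes "prime p" "a < p" "3 * a = 2 * p + s"
  shows "[(\<Sum>c=0..a. (-1) ^ c * int (a choose c) ^ 3 * int_gbinomial (4 * int a - 5 * int c) s) = 0] (mod int p)"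
proof -
  define m where "m = p - 1 - a"
  \<comment> \<open>\<open>3 * m + s = 3 * (p - 1) - (3 * a - s)\<close>, and
    \<open>3 * a - s = 2 * p\<close>.\<close>
  have deg: "3 * m + s = p - 3" "p \<ge> 3" "s < p" "m < p"
    using assms by (auto simp: m_def)
  define Q where "Q = (\<Prod>i=0..<m. [:int m - int i, 1:])"
  define R where "R = (\<Prod>i=0..<s. [:4 * int a - int i, -5:])"
  let ?t = "\<lambda>c. (-1) ^ c * int (a choose c) ^ 3 * int_gbinomial (4 * int a - 5 * int c) s"
  have "Polynomial.degree Q \<le> m" "Polynomial.degree R \<le> s"
    using degree_prod_sum_le[of "{0..<m}" "\<lambda>i. [:int m - int i, 1:]"]
      degree_prod_sum_le[of "{0..<s}" "\<lambda>i. [:4 * int a - int i, -5:]"]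
    by (simp_all add: Q_def R_def)
  moreover have "Polynomial.degree (Q ^ 3 * R) \<le> Polynomial.degree Q * 3 + Polynomial.degree R"
    using degree_mult_le[of "Q ^ 3" R] degree_power_le[of Q 3] by linarith
  ultimately have "Polynomial.degree (Q ^ 3 * R) < p - 1"
    using deg by linarith
  then have "[(\<Sum>c<p. poly (Q ^ 3 * R) (int c)) = 0] (mod int p)"
    by (rule poly_sum_cong_0[OF assms(1)])
  moreover have "[(\<Sum>c<p. ?t c * (fact m ^ 3 * fact s)) = (\<Sum>c<p. poly (Q ^ 3 * R) (int c))] (mod int p)"
  proof (rule cong_sum)
    fix c assume "c \<in> {..<p}"
    then have "c < p" by simp
    have "poly Q (int c) = (\<Prod>i=0..<m. int c + int m - int i)"
      by (simp add: Q_def poly_prod algebra_simps)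
    then have "[(-1) ^ c * int (a choose c) * fact m = poly Q (int c)] (mod int p)"
      using binomial_cong_polynomial[OF assms(1,2) \<open>c < p\<close>] by (simp add: m_def)
    moreover have "int_gbinomial (4 * int a - 5 * int c) s * fact s = poly R (int c)"
      unfolding int_gbinomial_mult_fact R_def poly_prod by (simp add: algebra_simps)
    ultimately have "[((-1) ^ c * int (a choose c) * fact m) ^ 3
        * (int_gbinomial (4 * int a - 5 * int c) s * fact s) = poly Q (int c) ^ 3 * poly R (int c)] (mod int p)"
      by (intro cong_mult cong_pow) simp_all
    moreover have "((-1 :: int) ^ c) ^ 3 = (-1) ^ c"
      by (simp add: minus_one_power_iff)
    ultimately show "[?t c * (fact m ^ 3 * fact s) = poly (Q ^ 3 * R) (int c)] (mod int p)"
      by (simp add: power_mult_distrib ac_simps)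
  qed
  ultimately have "[(\<Sum>c<p. ?t c) * (fact m ^ 3 * fact s) = 0] (mod int p)"
    unfolding sum_distrib_right by (rule cong_trans[rotated])
  then have "int p dvd (\<Sum>c<p. ?t c) * (fact m ^ 3 * fact s)"
    by (simp only: cong_0_iff)
  moreover have "\<not> int p dvd fact m" "\<not> int p dvd fact s"
    using deg assms(1) prime_dvd_fact_iff[of p m] prime_dvd_fact_iff[of p s]
    by (metis int_dvd_int_iff of_nat_fact leD)+
  ultimately have "int p dvd (\<Sum>c<p. ?t c)"
    using assms(1) by (simp add: prime_dvd_mult_iff prime_dvd_power_iff)
  moreover have "(\<Sum>c<p. ?t c) = (\<Sum>c=0..a. ?t c)"
    using assms(2) by (intro sum.mono_neutral_right) (auto simp: binomial_eq_0)
  ultimately show ?thesis by (simp add: cong_0_iff)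
qed

text \<open>In the digit expansion of \<open>seq_eta\<close>, \<open>q\<close> and \<open>r\<close> are the carries of \<open>4 a - 5 c\<close> and \<open>3 a\<close>.\<close>

definition eta_shift :: "nat \<Rightarrow> int \<Rightarrow> nat \<Rightarrow> int" where
  "eta_shift n q r = (\<Sum>k=0..n. (-1) ^ k * int (n choose k) ^ 3
     * int_gbinomial (4 * int n - 5 * int k + q) (3 * n + r))"

lemma eta_shift_0: "eta_shift n 0 0 = seq_eta n"
  by (simp add: eta_shift_def seq_eta_def)

lemma eta_shift_Suc: "eta_shift n (q + 1) (Suc r) = eta_shift n q r + eta_shift n q (Suc r)"
proof -
  have "int_gbinomial (4 * int n - 5 * int k + (q + 1)) (3 * n + Suc r)
      = int_gbinomial (4 * int n - 5 * int k + q) (3 * n + r)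
      + int_gbinomial (4 * int n - 5 * int k + q) (3 * n + Suc r)" for k
    using int_gbinomial_Suc_Suc[of "4 * int n - 5 * int k + q" "3 * n + r"] by (simp add: add.assoc)
  then show ?thesis
    by (simp add: eta_shift_def distrib_left sum.distrib del: add_Suc_right)
qed

text \<open>Summation is reversed and the upper entry negated: \<open>3 * n + r - 1\<close> minus
  \<open>- n + 5 * k + q\<close> is \<open>4 * n - 5 * k + (r - 1 - q)\<close>.\<close>

lemma eta_shift_reflect: "eta_shift n q r = (-1) ^ r * eta_shift n (int r - 1 - q) r"
proof -
  have "eta_shift n q r = (\<Sum>k=0..n. (-1) ^ (n - k) * int (n choose (n - k)) ^ 3
     * int_gbinomial (4 * int n - 5 * int (n - k) + q) (3 * n + r))"
    unfolding eta_shift_def by (subst sum.atLeastAtMost_rev) simp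
  also have "\<dots> = (\<Sum>k=0..n. (-1) ^ r * ((-1) ^ k * int (n choose k) ^ 3
     * int_gbinomial (4 * int n - 5 * int k + (int r - 1 - q)) (3 * n + r)))"
  proof (rule sum.cong)
    fix k assume "k \<in> {0..n}"
    then have k: "k \<le> n" by simp
    have "int_gbinomial (4 * int n - 5 * int (n - k) + q) (3 * n + r)
        = (-1) ^ (3 * n + r) * int_gbinomial (4 * int n - 5 * int k + (int r - 1 - q)) (3 * n + r)"
      using int_gbinomial_negated_upper[of "4 * int n - 5 * int (n - k) + q" "3 * n + r"] k
      by (simp add: algebra_simps)
    moreover have "(-1 :: int) ^ (n - k) * (-1) ^ (3 * n + r) = (-1) ^ r * (-1) ^ k"
      using k by (simp add: minus_one_power_iff)
    ultimately show "(-1) ^ (n - k) * int (n choose (n - k)) ^ 3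
        * int_gbinomial (4 * int n - 5 * int (n - k) + q) (3 * n + r)
      = (-1) ^ r * ((-1) ^ k * int (n choose k) ^ 3
        * int_gbinomial (4 * int n - 5 * int k + (int r - 1 - q)) (3 * n + r))"
      using binomial_symmetric[OF k] by (simp add: ac_simps)
  qed simp
  finally show ?thesis
    by (simp add: eta_shift_def sum_distrib_left)
qed

text \<open>The residual sum \<open>eta_shift n 0 2\<close> does not vanish in general; only its total
  coefficient in the digit expansion is divisible by \<open>p\<close> (\<open>binomial_cube_sum_cong_0\<close>).\<close>

lemma eta_shift_eq:
  assumes "-1 \<le> q" "q \<le> int r" "r \<le> 2"
  shows "eta_shift n q r = seq_eta n * int_gbinomial q r + (if r = 2 then eta_shift n 0 2 else 0)"
proof -
  have g: "int_gbinomial (-1) 1 = -1" "int_gbinomial 0 1 = 0" "int_gbinomial 1 1 = 1"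
    "int_gbinomial (-1) 2 = 1" "int_gbinomial 0 2 = 0" "int_gbinomial 1 2 = 0" "int_gbinomial 2 2 = 1"
    by (simp_all add: int_gbinomial_def numeral_2_eq_2)
  have f: "eta_shift n (-1) 0 = seq_eta n"
    using eta_shift_reflect[of n "-1" 0] by (simp add: eta_shift_0)
  \<comment> \<open>For \<open>r = 1\<close> the reflection fixes \<open>q = 0\<close> with sign -1,
    so this sum vanishes. Pascal's rule gives \<open>q = 1\<close>, and reflection then
    \<open>q = -1\<close>.\<close>
  have f1: "eta_shift n 0 1 = 0" "eta_shift n 1 1 = seq_eta n" "eta_shift n (-1) 1 = - seq_eta n"
    using eta_shift_reflect[of n 0 1] eta_shift_reflect[of n "-1" 1] eta_shift_Suc[of n 0 0]
    by (simp_all add: eta_shift_0)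
  \<comment> \<open>For \<open>r = 2\<close> Pascal's rule climbs from \<open>q = 0\<close> to 1 and
    2, and the reflection \<open>q \<mapsto> 1 - q\<close> pairs 2 with -1.\<close>
  have f2: "eta_shift n 1 2 = eta_shift n 0 2" "eta_shift n 2 2 = seq_eta n + eta_shift n 0 2"
    "eta_shift n (-1) 2 = seq_eta n + eta_shift n 0 2"
    using eta_shift_reflect[of n "-1" 2] eta_shift_Suc[of n 0 1] eta_shift_Suc[of n 1 1] f1
    by (simp_all add: numeral_2_eq_2)
  have "r = 0 \<or> r = 1 \<or> r = 2" "q = -1 \<or> q = 0 \<or> q = 1 \<or> q = 2"
    using assms by linarith+
  then consider "r = 0" "q = -1" | "r = 0" "q = 0" | "r = 1" "q = -1" | "r = 1" "q = 0" | "r = 1" "q = 1"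
    | "r = 2" "q = -1" | "r = 2" "q = 0" | "r = 2" "q = 1" | "r = 2" "q = 2"
    using assms(2) by (elim disjE) simp_all
  then show ?thesis
    by cases (simp_all only: g f f1 f2 eta_shift_0, simp_all)
qed

text \<open>\<open>eta_shift_eq\<close> replaces each inner sum by
  \<open>seq_eta b * int_gbinomial q r\<close>, and Lucas' theorem read backwards joins this
  coefficient with the last digit to give \<open>seq_eta a\<close>. The extra term for
  \<open>r = 2\<close> does not depend on \<open>c\<close>, so its coefficient is the full sum of
  \<open>w c\<close>.\<close>

lemma lucas_seq_eta: "lucas_mod p seq_eta" if "prime p"
proof (rule lucas_modI)
  fix a b assume a: "a < p"
  have p: "p > 0" using a by simp
  define x where "x c = 4 * int a - 5 * int c" for c
  define r s where "r = 3 * a div p" and "s = 3 * a mod p"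
  have rs: "3 * a = s + p * r" "s < p" using p by (simp_all add: r_def s_def)
  have r2: "r \<le> 2"
    using a p by (simp add: r_def less_mult_imp_div_less flip: less_Suc_eq_le)
  define w where "w c = int (a choose c) * ((-1) ^ c * int (a choose c) ^ 2 * int_gbinomial (x c mod int p) s)" for c
  have eq: "seq_eta n = (\<Sum>k=0..n. int (n choose k) * ((-1) ^ k * int (n choose k) ^ 2
       * int_gbinomial (4 * int n - 5 * int k) (3 * n)))" for n
    by (simp add: seq_eta_def power3_eq_cube power2_eq_square ac_simps)
  have "[seq_eta (a + p * b) = (\<Sum>c=0..a. w c * eta_shift b (x c div int p) r)] (mod int p)"
  proof -
    let ?n = "a + p * b"
    have "[seq_eta ?n = (\<Sum>c=0..a. int (a choose c) * ((-1) ^ c * int (a choose c) ^ 2 * int_gbinomial (x c mod int p) s)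
      * (\<Sum>d=0..b. int (b choose d) * ((-1) ^ d * int (b choose d) ^ 2
       * int_gbinomial (4 * int b - 5 * int d + x c div int p) (3 * b + r))))] (mod int p)"
      unfolding eq[of ?n]
    proof (rule sum_binomial_digits_cong[OF that a])
      fix c d assume cd: "c \<le> a" "d \<le> b"
      have "4 * int ?n - 5 * int (c + p * d) = x c + int p * (4 * int b - 5 * int d)"
        "3 * ?n = 3 * a + p * (3 * b)"
        by (simp_all add: x_def algebra_simps)
      then have "[int_gbinomial (4 * int ?n - 5 * int (c + p * d)) (3 * ?n)
         = int_gbinomial (x c mod int p) s * int_gbinomial (4 * int b - 5 * int d + x c div int p) (3 * b + r)] (mod int p)"
        using int_gbinomial_digits_cong[OF that, of "x c" "4 * int b - 5 * int d" "3 * a" "3 * b"]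
        by (simp only: r_def s_def)
      then show "[(-1) ^ (c + p * d) * int (?n choose (c + p * d)) ^ 2
          * int_gbinomial (4 * int ?n - 5 * int (c + p * d)) (3 * ?n)
        = ((-1) ^ c * int (a choose c) ^ 2 * int_gbinomial (x c mod int p) s)
        * ((-1) ^ d * int (b choose d) ^ 2
          * int_gbinomial (4 * int b - 5 * int d + x c div int p) (3 * b + r))] (mod int p)"
        using a cd by (intro digit_cong_intros that) auto
    qed
    then show ?thesis
      by (simp add: w_def eta_shift_def power3_eq_cube power2_eq_square ac_simps)
  qed
  also have "(\<Sum>c=0..a. w c * eta_shift b (x c div int p) r)
      = (\<Sum>c=0..a. w c * (seq_eta b * int_gbinomial (x c div int p) r + (if r = 2 then eta_shift b 0 2 else 0)))"
  proof (rule sum.cong)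
    fix c assume c: "c \<in> {0..a}"
    let ?q = "x c div int p"
    have "- int p < x c" using c a by (auto simp: x_def)
    then have q: "-1 \<le> ?q"
      using p zdiv_mono1[of "- int p" "x c" "int p"] by (simp add: zdiv_zminus1_eq_if)
    \<comment> \<open>If \<open>?q > r\<close>, then \<open>x c \<le> 4 * a = a + s + p * r\<close>
      leaves a last digit of at most \<open>a + s - p < s\<close>, so the coefficient
      vanishes.\<close>
    have "?q \<le> int r \<or> int_gbinomial (x c mod int p) s = 0"
    proof (cases "?q \<le> int r")
      case False
      then have "int p * (int r + 1) \<le> int p * ?q" by (intro mult_left_mono) auto
      then have "int p * int r + int p \<le> int p * ?q" by (simp add: algebra_simps)
      moreover have "x c \<le> int a + (int s + int p * int r)"
        using arg_cong[OF rs(1), of int] by (simp add: x_def)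
      ultimately have "x c mod int p < int s"
        using a mult_div_mod_eq[of "int p" "x c"] by linarith
      then show ?thesis
        using p by (simp add: int_gbinomial_eq_0)
    qed simp
    then show "w c * eta_shift b ?q r
      = w c * (seq_eta b * int_gbinomial ?q r + (if r = 2 then eta_shift b 0 2 else 0))"
      using eta_shift_eq[OF q _ r2, of b] by (auto simp: w_def)
  qed simp
  also have "\<dots> = (\<Sum>c=0..a. w c * int_gbinomial (x c div int p) r) * seq_eta b
      + (if r = 2 then (\<Sum>c=0..a. w c) * eta_shift b 0 2 else 0)"
    by (simp add: distrib_left sum.distrib sum_distrib_left sum_distrib_right ac_simps)
  also have "[\<dots> = seq_eta a * seq_eta b + 0] (mod int p)"
  proof (intro cong_add cong_mult cong_refl)
    show "[(\<Sum>c=0..a. w c * int_gbinomial (x c div int p) r) = seq_eta a] (mod int p)"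
      unfolding eq[of a]
    proof (rule cong_sum)
      fix c
      show "[w c * int_gbinomial (x c div int p) r = int (a choose c)
        * ((-1) ^ c * int (a choose c) ^ 2 * int_gbinomial (4 * int a - 5 * int c) (3 * a))] (mod int p)"
        using int_gbinomial_lucas[OF that, of "x c" "3 * a"]
        unfolding w_def mult.assoc r_def s_def by (intro cong_mult cong_refl) (simp add: x_def cong_sym_eq)
    qed
    show "[(if r = 2 then (\<Sum>c=0..a. w c) * eta_shift b 0 2 else 0) = 0] (mod int p)"
    proof (cases "r = 2")
      case True
      have "[(\<Sum>c=0..a. w c) = (\<Sum>c=0..a. (-1) ^ c * int (a choose c) ^ 3 * int_gbinomial (4 * int a - 5 * int c) s)] (mod int p)"
      proof (rule cong_sum)
        fix c
        have "[w c = int (a choose c) * ((-1) ^ c * int (a choose c) ^ 2 * int_gbinomial (x c) s)] (mod int p)"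
          using int_gbinomial_mod_cong[OF that rs(2), of "x c"]
          unfolding w_def by (intro cong_mult cong_refl) (simp add: cong_sym_eq)
        then show "[w c = (-1) ^ c * int (a choose c) ^ 3 * int_gbinomial (4 * int a - 5 * int c) s] (mod int p)"
          by (simp add: x_def power3_eq_cube power2_eq_square ac_simps)
      qed
      moreover have "[(\<Sum>c=0..a. (-1) ^ c * int (a choose c) ^ 3 * int_gbinomial (4 * int a - 5 * int c) s) = 0] (mod int p)"
        using rs(1) True by (intro binomial_cube_sum_cong_0[OF that a]) simp
      ultimately have "[(\<Sum>c=0..a. w c) = 0] (mod int p)"
        by (rule cong_trans)
      then show ?thesis
        using True by (simp add: cong_0_iff)
    qed simp
  qed
  finally show "[seq_eta (a + p * b) = seq_eta a * seq_eta b] (mod int p)" by simp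
qed

theorem theorem3p1:
  fixes C :: "nat \<Rightarrow> int"
  assumes "C \<in> {seq_a, seq_b, seq_c, seq_d, seq_f, seq_g, seq_delta, seq_eta, seq_alpha,
                 seq_epsilon, seq_zeta, seq_gamma, seq_s7, seq_s10, seq_s18}"
  shows "lucas_congruences C"
proof (rule lucas_congruencesI)
  fix p :: nat
  assume "prime p"
  note lucas_seqs = lucas_seq_a lucas_seq_b lucas_seq_c lucas_seq_d lucas_seq_f lucas_seq_g
    lucas_seq_delta lucas_seq_eta lucas_seq_alpha lucas_seq_epsilon lucas_seq_zeta lucas_seq_gamma
    lucas_seq_s7 lucas_seq_s10 lucas_seq_s18
  from assms show "lucas_mod p C"
    by (elim insertE emptyE) (simp_all only: lucas_seqs[OF \<open>prime p\<close>])
qed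

end
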